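(* $\mathsf{tJ}(\emptyset)\equiv_{\mathrm W}\mathrm{id}$, where $\emptyset$ is the problem with empty domain and $\mathrm{id}:\mathbb{N}^{\mathbb{N}}\to\mathbb{N}^{\mathbb{N}}$ is the identity.
   Context: A problem is a partial multi-valued function $f:\subseteq\mathbb{N}^{\mathbb{N}}\rightrightarrows\mathbb{N}^{\mathbb{N}}$, with $\mathrm{dom}(f)=\{p: f(p)\ne\emptyset\}$. $f\le_{\mathrm W} g$ means there are partial computable functionals $\Phi:\subseteq\mathbb{N}^{\mathbb{N}}\to\mathbb{N}^{\mathbb{N}}$ and $\Psi:\subseteq\mathbb{N}^{\mathbb{N}}\times\mathbb{N}^{\mathbb{N}}\to\mathbb{N}^{\mathbb{N}}$ such that for every $p\in\mathrm{dom}(f)$: $\Phi(p)\in\mathrm{dom}(g)$ and $\Psi(p,q)\in f(p)$ for every $q\in g(\Phi(p))$. $f\equiv_{\mathrm W} g$ means $f\le_{\mathrm W} g$ and $g\le_{\mathrm W} f$. Finite products of copies of $\mathbb{N}$ and $\mathbb{N}^{\mathbb{N}}$ are identified with $\mathbb{N}^{\mathbb{N}}$ via standard computable codings. $(\Phi_e)_{e\in\mathbb{N}}$ is a fixed standard computable enumeration of the partial computable functionals on $\mathbb{N}^{\mathbb{N}}$; $\Phi_i(p,q)$ means $\Phi_i$ applied to the pair $(p,q)$; $\downarrow$ means defined. Tot-jump: for $e,i\in\mathbb{N}$, $p\in\mathbb{N}^{\mathbb{N}}$, $\mathsf{tJ}(f)(e,i,p)=\{\Phi_i(p,q): q\in f(\Phi_e(p))\}$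 if $\Phi_e(p)\in\mathrm{dom}(f)$ and $\Phi_i(p,q)\downarrow$ for all $q\in f(\Phi_e(p))$; otherwise $\mathsf{tJ}(f)(e,i,p)=\mathbb{N}^{\mathbb{N}}$. *)

theory Defs
  imports Main "HOL-Library.Nat_Bijection"
begin

section \<open>Partial computable functionals on Baire space\<close>

type_synonym baire = "nat \<Rightarrow> nat"

text \<open>
  Programs for the partial functions from numbers to numbers that are recursive in an oracle
  \<open>p\<close>. All functions are unary; several arguments are passed through the Cantor pairing
  \<^const>\<open>prod_encode\<close>.
\<close>

datatype prog =
    PZero
  | PSucc
  | PFst
  | PSnd
  | POracle
  | PPair prog prog
  | PComp prog prog
  | PRec prog prog
  | PMu prog

text \<open>
  \<open>PRec c d\<close> on \<open>(a, n)\<close> is primitive recursion on \<open>n\<close> with parameter \<open>a\<close>, base \<open>c\<close> and step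
  \<open>d\<close> (called with \<open>(a, (k, y))\<close>). \<open>PMu c\<close> on \<open>x\<close> searches for the first \<open>n\<close> with
  \<open>c (x, n) = 0\<close> and diverges if some value before it is undefined.
\<close>

primrec run :: "baire \<Rightarrow> prog \<Rightarrow> nat \<Rightarrow> nat option" where
  "run p PZero x = Some 0"
| "run p PSucc x = Some (Suc x)"
| "run p PFst x = Some (fst (prod_decode x))"
| "run p PSnd x = Some (snd (prod_decode x))"
| "run p POracle x = Some (p x)"
| "run p (PPair c d) x =
     Option.bind (run p c x) (\<lambda>a. Option.bind (run p d x) (\<lambda>b. Some (prod_encode (a, b))))"
| "run p (PComp c d) x = Option.bind (run p d x) (run p c)"
| "run p (PRec c d) x =
     (case prod_decode x of (a, n) \<Rightarrow>
        rec_nat (run p c a)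
          (\<lambda>k r. Option.bind r (\<lambda>y. run p d (prod_encode (a, prod_encode (k, y))))) n)"
| "run p (PMu c) x =
     (let halts = (\<lambda>n. run p c (prod_encode (x, n)) = Some 0 \<and>
                       (\<forall>m<n. run p c (prod_encode (x, m)) \<noteq> None))
      in if \<exists>n. halts n then Some (LEAST n. halts n) else None)"

text \<open>
  The functional computed by a program is defined at \<open>p\<close> iff the program with oracle \<open>p\<close> halts
  on every input, i.e. every entry of the output sequence is produced.
\<close>

definition functional :: "prog \<Rightarrow> baire \<Rightarrow> baire option" where
  "functional c p =
     (if \<forall>n. run p c n \<noteq> None then Some (\<lambda>n. the (run p c n)) else None)"

definition computable_functional :: "(baire \<Rightarrow> baire option) \<Rightarrow> bool" where
  "computable_functional F \<longleftrightarrow> (\<exists>c. F = functional c)"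

text \<open>An effective bijective numbering of programs.\<close>

fun prog_code :: "prog \<Rightarrow> nat" where
  "prog_code PZero = 0"
| "prog_code PSucc = 1"
| "prog_code PFst = 2"
| "prog_code PSnd = 3"
| "prog_code POracle = 4"
| "prog_code (PPair c d) = 5 + 4 * prod_encode (prog_code c, prog_code d)"
| "prog_code (PComp c d) = 6 + 4 * prod_encode (prog_code c, prog_code d)"
| "prog_code (PRec c d) = 7 + 4 * prod_encode (prog_code c, prog_code d)"
| "prog_code (PMu c) = 8 + 4 * prog_code c"

lemma fst_prod_decode_le: "fst (prod_decode n) \<le> n"
  using le_prod_encode_1[of "fst (prod_decode n)" "snd (prod_decode n)"] by simp

lemma snd_prod_decode_le: "snd (prod_decode n) \<le> n"
  using le_prod_encode_2[of "snd (prod_decode n)" "fst (prod_decode n)"] by simp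

function prog_of :: "nat \<Rightarrow> prog" where
  "prog_of n =
     (if n = 0 then PZero
      else if n = 1 then PSucc
      else if n = 2 then PFst
      else if n = 3 then PSnd
      else if n = 4 then POracle
      else let m = (n - 5) div 4; a = fst (prod_decode m); b = snd (prod_decode m) in
        if (n - 5) mod 4 = 0 then PPair (prog_of a) (prog_of b)
        else if (n - 5) mod 4 = 1 then PComp (prog_of a) (prog_of b)
        else if (n - 5) mod 4 = 2 then PRec (prog_of a) (prog_of b)
        else PMu (prog_of m))"
  by pat_completeness auto
termination
proof (relation "measure id", goal_cases)
  case 1 show ?case by simp
qed (auto intro!: le_less_trans[OF fst_prod_decode_le] le_less_trans[OF snd_prod_decode_le])

declare prog_of.simps [simp del]

lemma prog_of_step:
  assumes "k < 4"
  shows "prog_of (5 + (4 * m + k)) =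
    (if k = 0 then PPair (prog_of (fst (prod_decode m))) (prog_of (snd (prod_decode m)))
     else if k = 1 then PComp (prog_of (fst (prod_decode m))) (prog_of (snd (prod_decode m)))
     else if k = 2 then PRec (prog_of (fst (prod_decode m))) (prog_of (snd (prod_decode m)))
     else PMu (prog_of m))"
proof -
  have "(4 * m + k) div 4 = m" "(4 * m + k) mod 4 = k"
    using assms by simp_all
  then show ?thesis
    by (subst prog_of.simps) (simp add: Let_def del: One_nat_def)
qed

lemma prog_of_code: "prog_of (prog_code c) = c"
proof (induction c)
  case (PPair c d)
  then show ?case using prog_of_step[of 0 "prod_encode (prog_code c, prog_code d)"] by simp
next
  case (PComp c d)
  then show ?case using prog_of_step[of 1 "prod_encode (prog_code c, prog_code d)"] by simp
next
  case (PRec c d)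
  then show ?case using prog_of_step[of 2 "prod_encode (prog_code c, prog_code d)"] by simp
next
  case (PMu c)
  then show ?case using prog_of_step[of 3 "prog_code c"] by simp
qed (simp_all add: prog_of.simps)

lemma prog_code_of: "prog_code (prog_of n) = n"
proof (induction n rule: less_induct)
  case (less n)
  define m where "m = (n - 5) div 4"
  show ?case
  proof (cases "n < 5")
    case True
    then have "n = 0 \<or> n = 1 \<or> n = 2 \<or> n = 3 \<or> n = 4" by auto
    then show ?thesis by (auto simp: prog_of.simps)
  next
    case False
    then have m: "m < n" by (auto simp: m_def)
    have IH: "prog_code (prog_of (fst (prod_decode m))) = fst (prod_decode m)"
      "prog_code (prog_of (snd (prod_decode m))) = snd (prod_decode m)"
      "prog_code (prog_of m) = m"
      using less m fst_prod_decode_le[of m] snd_prod_decode_le[of m] by (meson le_less_trans)+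
    define k where "k = (n - 5) mod 4"
    have n: "n = 5 + (4 * m + k)" and k: "k < 4"
      using False unfolding m_def k_def by simp_all
    from k consider "k = 0" | "k = 1" | "k = 2" | "k = 3" by linarith
    then show ?thesis
      unfolding n prog_of_step[OF k] using IH by cases simp_all
  qed
qed

definition Phi :: "nat \<Rightarrow> baire \<Rightarrow> baire option" where
  "Phi e = functional (prog_of e)"

lemma range_Phi: "range Phi = Collect computable_functional"
  unfolding Phi_def computable_functional_def
  by (auto simp: image_iff) (metis prog_of_code)


section \<open>Problems and Weihrauch reducibility\<close>

text \<open>
  The coding of pairs of sequences interleaves them; the coding of triples \<open>(e, i, p)\<close> of two
  numbers and a sequence prepends the numbers to the sequence.
\<close>

definition pair :: "baire \<Rightarrow> baire \<Rightarrow> baire" where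
  "pair p q = (\<lambda>n. if even n then p (n div 2) else q (n div 2))"

definition triple :: "nat \<Rightarrow> nat \<Rightarrow> baire \<Rightarrow> baire" where
  "triple e i p = case_nat e (case_nat i p)"

definition untriple :: "baire \<Rightarrow> nat \<times> nat \<times> baire" where
  "untriple r = (r 0, r 1, \<lambda>n. r (n + 2))"

lemma untriple_triple: "untriple (triple e i p) = (e, i, p)"
  by (simp add: untriple_def triple_def)

lemma triple_untriple: "(case untriple r of (e, i, p) \<Rightarrow> triple e i p) = r"
  by (auto simp: untriple_def triple_def fun_eq_iff numeral_2_eq_2 split: nat.split)

type_synonym problem = "baire \<Rightarrow> baire set"

definition pdom :: "problem \<Rightarrow> baire set" where
  "pdom f = {p. f p \<noteq> {}}"

definition weihrauch_le :: "problem \<Rightarrow> problem \<Rightarrow> bool" (infix "\<le>\<^sub>W" 50) where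
  "f \<le>\<^sub>W g \<longleftrightarrow>
     (\<exists>F G. computable_functional F \<and> computable_functional G \<and>
       (\<forall>p\<in>pdom f. \<exists>r\<in>pdom g. F p = Some r \<and>
          (\<forall>q\<in>g r. \<exists>s\<in>f p. G (pair p q) = Some s)))"

definition weihrauch_eq :: "problem \<Rightarrow> problem \<Rightarrow> bool" (infix "\<equiv>\<^sub>W" 50) where
  "f \<equiv>\<^sub>W g \<longleftrightarrow> f \<le>\<^sub>W g \<and> g \<le>\<^sub>W f"

definition empty_problem :: problem where
  "empty_problem p = {}"

definition id_problem :: problem where
  "id_problem p = {p}"


section \<open>The tot-jump\<close>

definition tJ :: "problem \<Rightarrow> problem" where
  "tJ f r =
     (case untriple r of (e, i, p) \<Rightarrow>
        if \<exists>s\<in>pdom f. Phi e p = Some s \<and> (\<forall>q\<in>f s. Phi i (pair p q) \<noteq> None)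
        then {the (Phi i (pair p q)) |q. q \<in> f (the (Phi e p))}
        else UNIV)"

end

theory Submission imports Defs begin

text \<open>
  Since \<^const>\<open>empty_problem\<close> has no instances, the first case of the tot-jump never applies, so
  \<^term>\<open>tJ empty_problem\<close> accepts every solution on every instance (\<open>tJ_empty_problem\<close>). Such a
  problem is reducible to the identity because a solution may be chosen without any regard to the
  instance. Conversely, to reduce the identity to it, the solution \<open>q\<close> carries no information, but
  the outer functional of a Weihrauch reduction also receives the original input \<open>p\<close> and can
  recover it from \<^term>\<open>pair p q\<close>. The only computation needed is therefore the first projection
  of a pair of sequences, which reads the oracle at the even positions
  (\<open>computable_functional_fst_pair\<close>).
\<close>

lemma tJ_empty_problem: "tJ empty_problem r = UNIV"
  by (simp add: tJ_def pdom_def empty_problem_def split: prod.split)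

lemma computable_functional_Some: "computable_functional Some"
proof -
  have "functional POracle = Some"
    by (simp add: functional_def fun_eq_iff)
  then show ?thesis
    unfolding computable_functional_def by metis
qed

text \<open>
  Programs have no identity primitive; \<^term>\<open>PPair PFst PSnd\<close> serves as one because
  \<^const>\<open>prod_decode\<close> is inverse to \<^const>\<open>prod_encode\<close>. Doubling then recurses on the input with a
  dummy parameter, adding two to the previous value in each step.
\<close>

definition double_prog :: prog where
  "double_prog =
     PComp (PRec PZero (PComp PSucc (PComp PSucc (PComp PSnd PSnd))))
           (PPair PZero (PPair PFst PSnd))"

lemma run_double_prog: "run p double_prog n = Some (2 * n)"
proof -
  have "run p (PRec PZero (PComp PSucc (PComp PSucc (PComp PSnd PSnd)))) (prod_encode (0, n))
      = Some (2 * n)"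
    by (induction n) simp_all
  then show ?thesis
    by (simp add: double_prog_def del: run.simps(8))
qed

lemma computable_functional_fst_pair:
  "\<exists>G. computable_functional G \<and> (\<forall>p q. G (pair p q) = Some p)"
proof (intro exI conjI allI)
  show "computable_functional (functional (PComp POracle double_prog))"
    unfolding computable_functional_def by blast
  show "functional (PComp POracle double_prog) (pair p q) = Some p" for p q
    by (simp add: functional_def run_double_prog pair_def)
qed

text \<open>
  Every output is a solution, so any two total functionals form a reduction; both are taken to be
  the identity.
\<close>

lemma weihrauch_le_id_if_all_solutions:
  assumes "\<And>p. f p = UNIV"
  shows "f \<le>\<^sub>W id_problem"
  unfolding weihrauch_le_def pdom_def id_problem_def assms
  using computable_functional_Some by blast

text \<open>
  The instance is passed on unchanged, and the output \<open>p\<close> is read off the even positions of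
  \<^term>\<open>pair p q\<close>. Totality of \<open>g\<close> ensures that the instance supplied to it is in its domain.
\<close>

lemma id_weihrauch_le_if_total:
  assumes "\<And>p. g p \<noteq> {}"
  shows "id_problem \<le>\<^sub>W g"
proof -
  obtain G where "computable_functional G" "\<forall>p q. G (pair p q) = Some p"
    using computable_functional_fst_pair by blast
  with computable_functional_Some assms show ?thesis
    unfolding weihrauch_le_def pdom_def id_problem_def
    by (intro exI[of _ Some] exI[of _ G]) simp
qed

theorem theorem4p1: "tJ empty_problem \<equiv>\<^sub>W id_problem"
  unfolding weihrauch_eq_def
  by (simp add: weihrauch_le_id_if_all_solutions id_weihrauch_le_if_total tJ_empty_problem)

end
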